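(* Let $\theta$ be a finite Blaschke product. Then the multiplication operator $M_\theta$, $M_\theta f=\theta f$, on $S_1^2(\mathbb{D})$ is a $3$-isometry. That is, for any $f\in S_1^2(\mathbb{D})$, $$\|\theta^3f\|^2-3\|\theta^2f\|^2+3\|\theta f\|^2-\|f\|^2=0,$$ where $\|\cdot\|=\|\cdot\|_{S_1^2}$.
   Context: $\mathbb{D}$ is the open unit disk and $H(\mathbb{D})$ the space of analytic functions on $\mathbb{D}$; for $f\in H(\mathbb{D})$ write $f(z)=\sum_{n\ge 0}f_nz^n$. The derivative Hardy space is the Hilbert space $S_1^2(\mathbb{D})=\{f\in H(\mathbb{D}):\|f\|_{S_1^2}^2=\sum_{n\ge0}\frac{(n+1)(n+2)}{2}|f_n|^2<\infty\}$. A bounded operator $T$ on a Hilbert space $H$ is an $m$-isometry ($m\ge1$ an integer) if $\sum_{k=0}^m(-1)^{m-k}\binom{m}{k}\|T^kh\|^2=0$ for all $h\in H$. *)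

theory Defs
  imports "HOL-Complex_Analysis.Complex_Analysis"
begin

text \<open>A function on the open unit disk is represented by its extension by zero, so that
  distinct elements of the sets below are distinct functions on the disk, and these sets are
  complex vector spaces under pointwise operations.\<close>

definition analytic_disk :: "(complex \<Rightarrow> complex) set" where
  "analytic_disk = {f. f holomorphic_on ball 0 1 \<and> (\<forall>z. z \<notin> ball 0 1 \<longrightarrow> f z = 0)}"

definition taylor_coeff :: "(complex \<Rightarrow> complex) \<Rightarrow> nat \<Rightarrow> complex" where
  "taylor_coeff f n = (deriv ^^ n) f 0 / fact n"

definition S12_term :: "(complex \<Rightarrow> complex) \<Rightarrow> nat \<Rightarrow> real" where
  "S12_term f n = (real n + 1) * (real n + 2) / 2 * (cmod (taylor_coeff f n))\<^sup>2"

definition S12 :: "(complex \<Rightarrow> complex) set" where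
  "S12 = {f \<in> analytic_disk. summable (S12_term f)}"

definition S12_norm :: "(complex \<Rightarrow> complex) \<Rightarrow> real" where
  "S12_norm f = sqrt (\<Sum>n. S12_term f n)"

definition bounded_operator_on ::
  "('a \<Rightarrow> complex) set \<Rightarrow> (('a \<Rightarrow> complex) \<Rightarrow> real) \<Rightarrow> (('a \<Rightarrow> complex) \<Rightarrow> ('a \<Rightarrow> complex)) \<Rightarrow> bool"
where
  "bounded_operator_on H nrm T \<longleftrightarrow>
     (\<forall>f\<in>H. T f \<in> H) \<and>
     (\<forall>f\<in>H. \<forall>g\<in>H. T (\<lambda>x. f x + g x) = (\<lambda>x. T f x + T g x)) \<and>
     (\<forall>c. \<forall>f\<in>H. T (\<lambda>x. c * f x) = (\<lambda>x. c * T f x)) \<and>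
     (\<exists>C. \<forall>f\<in>H. nrm (T f) \<le> C * nrm f)"

text \<open>The Hilbert space is given by its underlying space of functions \<open>H\<close> and its norm \<open>nrm\<close>,
  the only data on which the notion depends.\<close>

definition m_isometry_on ::
  "('a \<Rightarrow> complex) set \<Rightarrow> (('a \<Rightarrow> complex) \<Rightarrow> real) \<Rightarrow> nat \<Rightarrow> (('a \<Rightarrow> complex) \<Rightarrow> ('a \<Rightarrow> complex)) \<Rightarrow> bool"
where
  "m_isometry_on H nrm m T \<longleftrightarrow>
     m \<ge> 1 \<and> bounded_operator_on H nrm T \<and>
     (\<forall>h\<in>H. (\<Sum>k=0..m. (-1) ^ (m - k) * real (m choose k) * (nrm ((T ^^ k) h))\<^sup>2) = 0)"

text \<open>The zeros are listed with multiplicity. The empty list is allowed and gives the unimodular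
  constants. Values outside the open disk are irrelevant.\<close>

definition finite_blaschke_product :: "(complex \<Rightarrow> complex) \<Rightarrow> bool" where
  "finite_blaschke_product \<theta> \<longleftrightarrow>
     (\<exists>c as. cmod c = 1 \<and> (\<forall>a\<in>set as. cmod a < 1) \<and>
        (\<forall>z\<in>ball 0 1. \<theta> z = c * (\<Prod>a\<leftarrow>as. (z - a) / (1 - cnj a * z))))"

definition mult_op :: "('a \<Rightarrow> complex) \<Rightarrow> ('a \<Rightarrow> complex) \<Rightarrow> ('a \<Rightarrow> complex)" where
  "mult_op \<theta> f = (\<lambda>z. \<theta> z * f z)"

end

theory Submission
  imports Defs
begin

text \<open>Why the theorem holds. On a power series \<open>F\<close> let \<open>E F = z F'\<close> be the Euler operator; it is a
  derivation and multiplies the \<open>n\<close>-th coefficient by \<open>n\<close>. Polarization of the weight,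
  \[ (n+1)(n+2)/2 = 1/4 + 3/4 (n+1)^2 - 1/4 n^2, \]
  writes the squared norm of \<open>F\<close> as a combination of squared Hardy norms (sums of squared
  moduli of the coefficients): those of \<open>F\<close>, \<open>F + E F\<close> and \<open>E F\<close>.

  A finite Blaschke product \<open>\<Theta>\<close> multiplies the Hardy space isometrically. The Leibniz rule gives
  \[ \Theta \, E(\Theta^k F) = \Theta^k (\Theta \, E F + k \, (E \Theta) F), \]
  so after cancelling the isometric factors \<open>\<Theta>\<close> and \<open>\<Theta>^k\<close>, the power \<open>k\<close> only survives in the
  form \<open>P + k B\<close> with \<open>P\<close>, \<open>B\<close> fixed elements of the Hardy space
  (\<open>deriv_hardy_sq_power_mult\<close>). The squared Hardy norm of \<open>P + k B\<close> is a quadratic polynomial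
  in \<open>k\<close>, and third differences of quadratic polynomials vanish. Premultiplying by \<open>\<Theta>\<close> avoids
  the exponent \<open>k - 1\<close>, so that \<open>k = 0\<close> needs no separate treatment.

  The two analytic inputs concern a single Blaschke factor \<open>b\<close>: multiplication by \<open>b\<close> is isometric
  on the Hardy space (\<open>isometric_multiplier_blaschke_factor\<close>), and multiplication by \<open>E b\<close> is bounded
  (\<open>bounded_multiplier_euler_blaschke_factor\<close>). Both are proved on coefficients, from the
  boundedness of multiplication by a geometric series of ratio less than one in modulus. The second input also makes the elements \<open>(E \<Theta>) F\<close> square-summable and
  gives the boundedness of the multiplication operator.\<close>

unbundle no vec_syntax

section \<open>Square-summable power series\<close>

definition hardy :: "complex fps set" where
  "hardy = {F. summable (\<lambda>n. (cmod (F $ n))\<^sup>2)}"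

definition hardy_sq :: "complex fps \<Rightarrow> real" where
  "hardy_sq F = (\<Sum>n. (cmod (F $ n))\<^sup>2)"

lemma hardy_summable: "F \<in> hardy \<Longrightarrow> summable (\<lambda>n. (cmod (F $ n))\<^sup>2)"
  by (simp add: hardy_def)

lemma hardy_sq_nonneg: "F \<in> hardy \<Longrightarrow> 0 \<le> hardy_sq F"
  unfolding hardy_sq_def by (intro suminf_nonneg hardy_summable) auto

lemma cmod_add_sq_le: "(cmod (x + y))\<^sup>2 \<le> 2 * (cmod x)\<^sup>2 + 2 * (cmod y)\<^sup>2"
proof -
  have "(cmod (x + y))\<^sup>2 \<le> (cmod x + cmod y)\<^sup>2"
    by (intro power_mono norm_triangle_ineq) auto
  also have "\<dots> \<le> 2 * (cmod x)\<^sup>2 + 2 * (cmod y)\<^sup>2"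
    using sum_squares_bound[of "cmod x" "cmod y"] by (simp add: power2_sum)
  finally show ?thesis .
qed

lemma
  assumes "F \<in> hardy" "G \<in> hardy"
  shows hardy_add: "F + G \<in> hardy"
    and hardy_sq_add_le: "hardy_sq (F + G) \<le> 2 * hardy_sq F + 2 * hardy_sq G"
proof -
  let ?b = "\<lambda>n. 2 * (cmod (F $ n))\<^sup>2 + 2 * (cmod (G $ n))\<^sup>2"
  have b: "summable ?b"
    by (intro summable_add summable_mult hardy_summable assms)
  have le: "(cmod ((F + G) $ n))\<^sup>2 \<le> ?b n" for n
    using cmod_add_sq_le by simp
  have s: "summable (\<lambda>n. (cmod ((F + G) $ n))\<^sup>2)"
    by (rule summable_comparison_test'[OF b, of 0]) (use le in auto)
  then show "F + G \<in> hardy" by (simp add: hardy_def)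
  have "hardy_sq (F + G) \<le> suminf ?b"
    unfolding hardy_sq_def by (rule suminf_le[OF le s b])
  also have "\<dots> = 2 * hardy_sq F + 2 * hardy_sq G"
    unfolding hardy_sq_def
    by (simp add: suminf_add[symmetric] suminf_mult summable_mult hardy_summable assms)
  finally show "hardy_sq (F + G) \<le> 2 * hardy_sq F + 2 * hardy_sq G" .
qed

lemma
  assumes "F \<in> hardy"
  shows hardy_const_mult: "fps_const c * F \<in> hardy"
    and hardy_sq_const_mult: "hardy_sq (fps_const c * F) = (cmod c)\<^sup>2 * hardy_sq F"
  using hardy_summable[OF assms]
  by (simp_all add: hardy_def hardy_sq_def norm_mult power_mult_distrib summable_mult suminf_mult)

lemma hardy_of_nat_mult: "F \<in> hardy \<Longrightarrow> of_nat k * F \<in> hardy"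
  using hardy_const_mult[of F "of_nat k"] by (simp add: fps_of_nat)

lemma
  assumes "F \<in> hardy"
  shows hardy_X_mult: "fps_X * F \<in> hardy"
    and hardy_sq_X_mult: "hardy_sq (fps_X * F) = hardy_sq F"
proof -
  let ?g = "\<lambda>n. (cmod ((fps_X * F) $ n))\<^sup>2"
  have "(\<lambda>n. ?g (Suc n)) sums hardy_sq F"
    using summable_sums[OF hardy_summable[OF assms]] by (simp add: hardy_sq_def)
  then have "?g sums hardy_sq F"
    using sums_Suc_iff[of ?g "hardy_sq F"] by simp
  then show "fps_X * F \<in> hardy" "hardy_sq (fps_X * F) = hardy_sq F"
    by (auto simp: hardy_def hardy_sq_def sums_iff)
qed

text \<open>The squared norm along a line in a Hilbert space is quadratic in the parameter; here this is
  checked coefficient by coefficient.\<close>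

lemma hardy_sq_third_difference:
  assumes "P \<in> hardy" "B \<in> hardy"
  shows "hardy_sq (P + of_nat 3 * B) - 3 * hardy_sq (P + of_nat 2 * B)
    + 3 * hardy_sq (P + of_nat 1 * B) - hardy_sq (P + of_nat 0 * B) = 0"
proof -
  let ?t = "\<lambda>k n. (cmod ((P + of_nat k * B) $ n))\<^sup>2"
  have s: "?t k sums hardy_sq (P + of_nat k * B)" for k
    unfolding hardy_sq_def
    by (intro summable_sums hardy_summable hardy_add hardy_of_nat_mult assms)
  have nth: "(P + of_nat k * B) $ n = P $ n + of_nat k * B $ n" for k n
    by (simp flip: fps_of_nat)
  have "(\<lambda>n. ?t 3 n - 3 * ?t 2 n + 3 * ?t 1 n - ?t 0 n) sums
     (hardy_sq (P + of_nat 3 * B) - 3 * hardy_sq (P + of_nat 2 * B)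
    + 3 * hardy_sq (P + of_nat 1 * B) - hardy_sq (P + of_nat 0 * B))"
    by (intro sums_diff sums_add sums_mult s)
  moreover have "?t 3 n - 3 * ?t 2 n + 3 * ?t 1 n - ?t 0 n = 0" for n
    unfolding nth cmod_power2 by (simp add: power2_eq_square algebra_simps)
  ultimately show ?thesis
    by (simp only:) (rule sums_unique2[OF _ sums_zero])
qed

section \<open>Multipliers of the Hardy space\<close>

definition bounded_multiplier :: "complex fps \<Rightarrow> bool" where
  "bounded_multiplier P \<longleftrightarrow>
     (\<exists>C. \<forall>F\<in>hardy. P * F \<in> hardy \<and> hardy_sq (P * F) \<le> C * hardy_sq F)"

definition isometric_multiplier :: "complex fps \<Rightarrow> bool" where
  "isometric_multiplier P \<longleftrightarrow>
     (\<forall>F\<in>hardy. P * F \<in> hardy \<and> hardy_sq (P * F) = hardy_sq F)"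

lemma isometric_multiplier_imp_bounded: "isometric_multiplier P \<Longrightarrow> bounded_multiplier P"
  unfolding isometric_multiplier_def bounded_multiplier_def
  by (rule exI[of _ 1]) auto

lemma isometric_multiplier_mult:
  "isometric_multiplier P \<Longrightarrow> isometric_multiplier Q \<Longrightarrow> isometric_multiplier (P * Q)"
  by (simp add: isometric_multiplier_def mult.assoc)

lemma isometric_multiplier_const: "cmod c = 1 \<Longrightarrow> isometric_multiplier (fps_const c)"
  by (simp add: isometric_multiplier_def hardy_const_mult hardy_sq_const_mult)

lemma isometric_multiplier_power: "isometric_multiplier P \<Longrightarrow> isometric_multiplier (P ^ k)"
proof (induction k)
  case 0
  then show ?case by (simp add: isometric_multiplier_def)
qed (simp add: isometric_multiplier_mult)

lemma bounded_multiplierE: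
  assumes "bounded_multiplier P"
  obtains C where "C \<ge> 0" "\<And>F. F \<in> hardy \<Longrightarrow> P * F \<in> hardy"
    "\<And>F. F \<in> hardy \<Longrightarrow> hardy_sq (P * F) \<le> C * hardy_sq F"
proof -
  from assms obtain C where C: "\<forall>F\<in>hardy. P * F \<in> hardy \<and> hardy_sq (P * F) \<le> C * hardy_sq F"
    by (auto simp: bounded_multiplier_def)
  have "hardy_sq (P * F) \<le> max 0 C * hardy_sq F" if "F \<in> hardy" for F
    using C that mult_right_mono[OF max.cobounded2[of C 0] hardy_sq_nonneg[OF that]] by force
  then show ?thesis using C that[of "max 0 C"] by simp
qed

lemma bounded_multiplier_add:
  assumes "bounded_multiplier P" "bounded_multiplier Q"
  shows "bounded_multiplier (P + Q)"
proof -
  obtain C where C: "\<And>F. F \<in> hardy \<Longrightarrow> P * F \<in> hardy"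
    "\<And>F. F \<in> hardy \<Longrightarrow> hardy_sq (P * F) \<le> C * hardy_sq F"
    using bounded_multiplierE[OF assms(1)] by metis
  obtain D where D: "\<And>F. F \<in> hardy \<Longrightarrow> Q * F \<in> hardy"
    "\<And>F. F \<in> hardy \<Longrightarrow> hardy_sq (Q * F) \<le> D * hardy_sq F"
    using bounded_multiplierE[OF assms(2)] by metis
  have "(P + Q) * F \<in> hardy \<and> hardy_sq ((P + Q) * F) \<le> (2 * C + 2 * D) * hardy_sq F"
    if F: "F \<in> hardy" for F
    using hardy_add[OF C(1) D(1), OF F F] hardy_sq_add_le[OF C(1) D(1), OF F F] C(2)[OF F] D(2)[OF F]
    by (simp add: distrib_right)
  then show ?thesis unfolding bounded_multiplier_def by blast
qed

lemma bounded_multiplier_mult: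
  assumes "bounded_multiplier P" "bounded_multiplier Q"
  shows "bounded_multiplier (P * Q)"
proof -
  obtain C where C: "C \<ge> 0" "\<And>F. F \<in> hardy \<Longrightarrow> P * F \<in> hardy"
    "\<And>F. F \<in> hardy \<Longrightarrow> hardy_sq (P * F) \<le> C * hardy_sq F"
    using bounded_multiplierE[OF assms(1)] by metis
  obtain D where D: "\<And>F. F \<in> hardy \<Longrightarrow> Q * F \<in> hardy"
    "\<And>F. F \<in> hardy \<Longrightarrow> hardy_sq (Q * F) \<le> D * hardy_sq F"
    using bounded_multiplierE[OF assms(2)] by metis
  have "P * Q * F \<in> hardy \<and> hardy_sq (P * Q * F) \<le> (C * D) * hardy_sq F"
    if F: "F \<in> hardy" for F
    using C(2)[OF D(1)[OF F]] order_trans[OF C(3)[OF D(1)[OF F]] mult_left_mono[OF D(2)[OF F] C(1)]]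
    by (simp add: mult.assoc)
  then show ?thesis unfolding bounded_multiplier_def by blast
qed

lemma bounded_multiplier_const: "bounded_multiplier (fps_const c)"
  unfolding bounded_multiplier_def
  by (rule exI[of _ "(cmod c)\<^sup>2"]) (simp add: hardy_const_mult hardy_sq_const_mult)

lemma bounded_multiplier_X: "bounded_multiplier fps_X"
  by (intro isometric_multiplier_imp_bounded)
     (simp add: isometric_multiplier_def hardy_X_mult hardy_sq_X_mult)

text \<open>Convexity of the square: \<open>y + r x\<close> is the average of \<open>y / (1 - r)\<close> and \<open>x\<close> with weights \<open>1 - r\<close>
  and \<open>r\<close>.\<close>

lemma convex_square_bound:
  fixes r x y :: real
  assumes "0 \<le> r" "r < 1"
  shows "(y + r * x)\<^sup>2 \<le> y\<^sup>2 / (1 - r) + r * x\<^sup>2"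
proof -
  have "y\<^sup>2 / (1 - r) + r * x\<^sup>2 - (y + r * x)\<^sup>2 = r * (y - (1 - r) * x)\<^sup>2 / (1 - r)"
    using assms by (simp add: field_simps power2_eq_square)
  also have "\<dots> \<ge> 0" using assms by simp
  finally show ?thesis by simp
qed

text \<open>The product \<open>G\<close> of \<open>F\<close> with the geometric series solves the recursion
  \<open>G n = F n + c * G (n - 1)\<close>. Squaring with the convexity bound and summing, the partial sums \<open>S\<close> of
  the squares of \<open>G\<close> satisfy \<open>S \<le> hardy_sq F / (1 - r) + r * S\<close> for \<open>r = cmod c\<close>, and the last term can
  be absorbed on the left.\<close>

lemma bounded_multiplier_geometric:
  assumes "cmod c < 1"
  shows "bounded_multiplier (inverse (1 - fps_const c * fps_X))"
proof -
  define r where "r = cmod c"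
  have r: "0 \<le> r" "r < 1" using assms by (auto simp: r_def)
  have "inverse (1 - fps_const c * fps_X) * F \<in> hardy \<and>
        hardy_sq (inverse (1 - fps_const c * fps_X) * F) \<le> 1 / (1 - r)\<^sup>2 * hardy_sq F"
    if F: "F \<in> hardy" for F
  proof -
    define G where "G = inverse (1 - fps_const c * fps_X) * F"
    have "(1 - fps_const c * fps_X) * G = F"
      unfolding G_def mult.assoc[symmetric] by (subst inverse_mult_eq_1') auto
    then have "G = F + fps_const c * (fps_X * G)"
      by (simp add: algebra_simps)
    then have G: "G $ n = F $ n + c * (fps_X * G) $ n" for n
      by (metis fps_add_nth fps_mult_left_const_nth)
    have step: "(cmod (G $ n))\<^sup>2 \<le> (cmod (F $ n))\<^sup>2 / (1 - r) + r * (cmod ((fps_X * G) $ n))\<^sup>2" for n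
    proof -
      have "cmod (G $ n) \<le> cmod (F $ n) + r * cmod ((fps_X * G) $ n)"
        using norm_triangle_ineq[of "F $ n" "c * (fps_X * G) $ n"] G[of n]
        by (simp add: norm_mult r_def)
      then have "(cmod (G $ n))\<^sup>2 \<le> (cmod (F $ n) + r * cmod ((fps_X * G) $ n))\<^sup>2"
        by (intro power_mono) auto
      also note convex_square_bound[OF r]
      finally show ?thesis .
    qed
    have partial: "(\<Sum>n<N. (cmod (G $ n))\<^sup>2) \<le> 1 / (1 - r)\<^sup>2 * hardy_sq F" for N
    proof -
      let ?S = "\<Sum>n<N. (cmod (G $ n))\<^sup>2"
      have shift: "(\<Sum>n<N. (cmod ((fps_X * G) $ n))\<^sup>2) \<le> ?S"
      proof (cases N)
        case (Suc M)
        have "(\<Sum>n<Suc M. (cmod ((fps_X * G) $ n))\<^sup>2) = (\<Sum>n<M. (cmod (G $ n))\<^sup>2)"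
          by (subst sum.lessThan_Suc_shift) simp
        then show ?thesis using Suc by simp
      qed simp
      have F_part: "(\<Sum>n<N. (cmod (F $ n))\<^sup>2) \<le> hardy_sq F"
        unfolding hardy_sq_def by (rule sum_le_suminf[OF hardy_summable[OF F]]) auto
      have "?S \<le> (\<Sum>n<N. (cmod (F $ n))\<^sup>2 / (1 - r) + r * (cmod ((fps_X * G) $ n))\<^sup>2)"
        by (rule sum_mono[OF step])
      also have "\<dots> = (\<Sum>n<N. (cmod (F $ n))\<^sup>2) / (1 - r)
          + r * (\<Sum>n<N. (cmod ((fps_X * G) $ n))\<^sup>2)"
        by (simp add: sum.distrib sum_divide_distrib sum_distrib_left)
      also have "\<dots> \<le> hardy_sq F / (1 - r) + r * ?S"
        using r by (intro add_mono divide_right_mono mult_left_mono shift F_part) auto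
      finally have "(1 - r) * ?S \<le> hardy_sq F / (1 - r)"
        by (simp add: algebra_simps)
      then have "?S \<le> hardy_sq F / (1 - r) / (1 - r)"
        using r by (subst pos_le_divide_eq) (auto simp: mult.commute)
      then show ?thesis
        by (simp add: power2_eq_square)
    qed
    have s: "summable (\<lambda>n. (cmod (G $ n))\<^sup>2)"
      by (rule summableI_nonneg_bounded[OF _ partial]) auto
    moreover have "hardy_sq G \<le> 1 / (1 - r)\<^sup>2 * hardy_sq F"
      unfolding hardy_sq_def[of G] by (rule suminf_le_const[OF s partial])
    ultimately show ?thesis by (simp add: G_def hardy_def)
  qed
  then show ?thesis unfolding bounded_multiplier_def by blast
qed

section \<open>Blaschke factors\<close>

text \<open>The Taylor expansion at the origin of \<open>(z - a) / (1 - cnj a * z)\<close>.\<close>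

definition blaschke_factor :: "complex \<Rightarrow> complex fps" where
  "blaschke_factor a = (fps_X - fps_const a) * inverse (1 - fps_const (cnj a) * fps_X)"

text \<open>On the unit circle numerator and denominator of a Blaschke factor have equal modulus. This is
  the homogeneous form of that fact, with the defect for \<open>cmod x \<noteq> cmod y\<close> made explicit.\<close>

lemma cmod_reflection:
  "(cmod (x - a * y))\<^sup>2 = (cmod (y - cnj a * x))\<^sup>2 + (1 - (cmod a)\<^sup>2) * ((cmod x)\<^sup>2 - (cmod y)\<^sup>2)"
  unfolding cmod_power2 by (simp add: power2_eq_square algebra_simps)

text \<open>With \<open>G = F / (1 - cnj a * z)\<close>, the claim compares \<open>(z - a) G\<close> with \<open>(1 - cnj a * z) G\<close>. By the reflection
  identity their squared norms differ by a multiple of the difference of those of \<open>z G\<close> and \<open>G\<close>,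
  which is zero because multiplication by \<open>z\<close> only shifts coefficients.\<close>

lemma isometric_multiplier_blaschke_factor:
  assumes "cmod a < 1"
  shows "isometric_multiplier (blaschke_factor a)"
  unfolding isometric_multiplier_def
proof
  fix F assume F: "F \<in> hardy"
  define D where "D = 1 - fps_const (cnj a) * fps_X"
  define G where "G = inverse D * F"
  have G: "G \<in> hardy"
    unfolding G_def D_def using bounded_multiplier_geometric[of "cnj a"] assms F
    by (auto elim: bounded_multiplierE)
  have "D * G = F"
    unfolding G_def D_def mult.assoc[symmetric] by (subst inverse_mult_eq_1') auto
  then have F_nth: "F $ n = G $ n - cnj a * (fps_X * G) $ n" for n
    unfolding D_def left_diff_distrib mult.assoc
    by (metis fps_mult_left_const_nth fps_sub_nth mult_1)
  have "blaschke_factor a * F = (fps_X - fps_const a) * G"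
    by (simp add: blaschke_factor_def G_def D_def mult.assoc)
  then have b_nth: "(blaschke_factor a * F) $ n = (fps_X * G) $ n - a * G $ n" for n
    by (simp add: left_diff_distrib)
  have "(cmod ((blaschke_factor a * F) $ n))\<^sup>2 = (cmod (F $ n))\<^sup>2 +
      (1 - (cmod a)\<^sup>2) * ((cmod ((fps_X * G) $ n))\<^sup>2 - (cmod (G $ n))\<^sup>2)" for n
    unfolding b_nth F_nth by (rule cmod_reflection)
  moreover have "(\<lambda>n. (cmod (F $ n))\<^sup>2 +
      (1 - (cmod a)\<^sup>2) * ((cmod ((fps_X * G) $ n))\<^sup>2 - (cmod (G $ n))\<^sup>2)) sums
      (hardy_sq F + (1 - (cmod a)\<^sup>2) * (hardy_sq (fps_X * G) - hardy_sq G))"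
    unfolding hardy_sq_def
    by (intro sums_add sums_mult sums_diff summable_sums hardy_summable F G hardy_X_mult)
  ultimately have "(\<lambda>n. (cmod ((blaschke_factor a * F) $ n))\<^sup>2) sums hardy_sq F"
    by (simp only: hardy_sq_X_mult[OF G] diff_self mult_zero_right add_0_right)
  then show "blaschke_factor a * F \<in> hardy \<and> hardy_sq (blaschke_factor a * F) = hardy_sq F"
    by (auto simp: hardy_def hardy_sq_def sums_iff)
qed

definition euler :: "complex fps \<Rightarrow> complex fps" where
  "euler F = fps_X * fps_deriv F"

lemma euler_nth [simp]: "euler F $ n = of_nat n * F $ n"
  by (cases n) (simp_all add: euler_def)

lemma euler_mult: "euler (F * G) = F * euler G + euler F * G"
  by (simp add: euler_def algebra_simps)

text \<open>The factor \<open>F\<close> on the left makes the rule for powers valid at \<open>k = 0\<close> too, without an exponent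
  \<open>k - 1\<close>.\<close>

lemma euler_power: "F * euler (F ^ k) = of_nat k * F ^ k * euler F"
proof (induction k)
  case 0
  show ?case by (simp add: euler_def)
next
  case (Suc k)
  have "F * euler (F ^ Suc k) = F * (F * euler (F ^ k)) + F ^ Suc k * euler F"
    by (simp add: euler_mult algebra_simps)
  also have "\<dots> = of_nat (Suc k) * F ^ Suc k * euler F"
    by (simp only: Suc) (simp add: algebra_simps)
  finally show ?case .
qed

text \<open>The series is a polynomial expression in constants, \<open>z\<close> and \<open>1 / (1 - cnj a * z)\<close>, and the bounded
  multipliers form an algebra.\<close>

lemma bounded_multiplier_euler_blaschke_factor:
  assumes "cmod a < 1"
  shows "bounded_multiplier (euler (blaschke_factor a))"
proof -
  define D where "D = 1 - fps_const (cnj a) * fps_X"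
  have D: "bounded_multiplier (inverse D)"
    unfolding D_def using assms by (intro bounded_multiplier_geometric) simp
  have "fps_deriv (inverse D) = fps_const (cnj a) * (inverse D * inverse D)"
    by (subst fps_inverse_deriv) (simp_all add: D_def power2_eq_square)
  then have "euler (inverse D) = fps_X * (fps_const (cnj a) * (inverse D * inverse D))"
    by (simp add: euler_def)
  moreover have "euler (fps_X - fps_const a) = fps_X"
    by (simp add: euler_def)
  ultimately have "euler (blaschke_factor a) =
      (fps_X + fps_const (- a)) * (fps_X * (fps_const (cnj a) * (inverse D * inverse D)))
        + fps_X * inverse D"
    unfolding blaschke_factor_def D_def[symmetric] euler_mult by (simp flip: fps_const_neg)
  then show ?thesis
    by (simp only:) (intro bounded_multiplier_add bounded_multiplier_mult bounded_multiplier_X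
      bounded_multiplier_const D)
qed

lemma blaschke_product_expansion:
  assumes "finite_blaschke_product \<theta>"
  obtains \<Theta> where "\<theta> has_fps_expansion \<Theta>" "isometric_multiplier \<Theta>"
    "bounded_multiplier (euler \<Theta>)"
proof -
  from assms obtain c as where c: "cmod c = 1" and as: "\<forall>a\<in>set as. cmod a < 1"
    and eq: "\<forall>z\<in>ball 0 1. \<theta> z = c * (\<Prod>a\<leftarrow>as. (z - a) / (1 - cnj a * z))"
    by (auto simp: finite_blaschke_product_def)
  define \<Theta> where "\<Theta> = fps_const c * (\<Prod>a\<leftarrow>as. blaschke_factor a)"
  have factor: "(\<lambda>z. (z - a) / (1 - cnj a * z)) has_fps_expansion blaschke_factor a" for a
    unfolding blaschke_factor_def divide_inverse
    by (intro fps_expansion_intros) auto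
  have "(\<lambda>z. \<Prod>a\<leftarrow>as. (z - a) / (1 - cnj a * z)) has_fps_expansion
      (\<Prod>a\<leftarrow>as. blaschke_factor a)"
  proof (induction as)
    case (Cons a as)
    then show ?case
      using has_fps_expansion_mult[OF factor[of a] Cons] by simp
  qed simp
  then have formula: "(\<lambda>z. c * (\<Prod>a\<leftarrow>as. (z - a) / (1 - cnj a * z))) has_fps_expansion \<Theta>"
    unfolding \<Theta>_def by (rule has_fps_expansion_cmult_left)
  have "eventually (\<lambda>z. \<theta> z = c * (\<Prod>a\<leftarrow>as. (z - a) / (1 - cnj a * z))) (nhds 0)"
    using eq by (intro eventually_nhds_in_open[of "ball 0 1", THEN eventually_mono]) auto
  from has_fps_expansion_cong[OF this refl] formula
  have expansion: "\<theta> has_fps_expansion \<Theta>" by (rule iffD2)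
  have prods: "isometric_multiplier (\<Prod>a\<leftarrow>as. blaschke_factor a) \<and>
      bounded_multiplier (euler (\<Prod>a\<leftarrow>as. blaschke_factor a))"
    using as
  proof (induction as)
    case Nil
    have "euler 1 = fps_const 0" by (simp add: euler_def)
    then show ?case
      using isometric_multiplier_const[of 1] bounded_multiplier_const[of 0] by simp
  next
    case (Cons a as)
    then have a: "isometric_multiplier (blaschke_factor a)"
      and a': "bounded_multiplier (euler (blaschke_factor a))"
      by (auto intro: isometric_multiplier_blaschke_factor bounded_multiplier_euler_blaschke_factor)
    have as: "isometric_multiplier (\<Prod>a\<leftarrow>as. blaschke_factor a)"
      and as': "bounded_multiplier (euler (\<Prod>a\<leftarrow>as. blaschke_factor a))"
      using Cons by auto
    show ?case
      using isometric_multiplier_mult[OF a as]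
        bounded_multiplier_add[OF
          bounded_multiplier_mult[OF isometric_multiplier_imp_bounded[OF a] as']
          bounded_multiplier_mult[OF a' isometric_multiplier_imp_bounded[OF as]]]
      by (simp add: euler_mult)
  qed
  have iso: "isometric_multiplier \<Theta>"
    unfolding \<Theta>_def
    by (rule isometric_multiplier_mult[OF isometric_multiplier_const[OF c] conjunct1[OF prods]])
  have "euler \<Theta> = fps_const c * euler (\<Prod>a\<leftarrow>as. blaschke_factor a)"
    by (simp add: \<Theta>_def euler_def mult.left_commute)
  with bounded_multiplier_mult[OF bounded_multiplier_const conjunct2[OF prods]]
  have "bounded_multiplier (euler \<Theta>)" by metis
  with expansion iso show ?thesis by (rule that)
qed

section \<open>The derivative Hardy space in terms of coefficients\<close>

definition weight_term :: "complex fps \<Rightarrow> nat \<Rightarrow> real" where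
  "weight_term F n = (real n + 1) * (real n + 2) / 2 * (cmod (F $ n))\<^sup>2"

definition deriv_hardy :: "complex fps set" where
  "deriv_hardy = {F \<in> hardy. euler F \<in> hardy}"

text \<open>The sum of \<open>weight_term F\<close>, as \<open>weight_term_sums\<close> shows; in this form every summand is a squared
  Hardy norm, to which isometric multipliers can be applied.\<close>

definition deriv_hardy_sq :: "complex fps \<Rightarrow> real" where
  "deriv_hardy_sq F =
     1/4 * hardy_sq F + 3/4 * hardy_sq (F + euler F) - 1/4 * hardy_sq (euler F)"

lemma weight_term_sums:
  assumes "F \<in> deriv_hardy"
  shows "weight_term F sums deriv_hardy_sq F"
proof -
  have F: "F \<in> hardy" "euler F \<in> hardy"
    using assms by (auto simp: deriv_hardy_def)
  have "weight_term F n = 1/4 * (cmod (F $ n))\<^sup>2 + 3/4 * (cmod ((F + euler F) $ n))\<^sup>2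
      - 1/4 * (cmod (euler F $ n))\<^sup>2" for n
  proof -
    have "(F + euler F) $ n = of_real (1 + real n) * F $ n"
      by (simp add: algebra_simps)
    then have "cmod ((F + euler F) $ n) = \<bar>1 + real n\<bar> * cmod (F $ n)"
      by (simp only: norm_mult norm_of_real)
    then show ?thesis
      by (simp add: weight_term_def norm_mult algebra_simps power2_eq_square)
  qed
  then show ?thesis
    unfolding deriv_hardy_sq_def hardy_sq_def
    by (subst sums_cong, assumption)
       (intro sums_add sums_diff sums_mult summable_sums hardy_summable F hardy_add)
qed

lemma hardy_term_le_weight_term: "(cmod (F $ n))\<^sup>2 \<le> weight_term F n"
proof -
  have "1 \<le> (real n + 1) * (real n + 2) / 2" by (simp add: algebra_simps)
  from mult_right_mono[OF this, of "(cmod (F $ n))\<^sup>2"] show ?thesis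
    by (simp add: weight_term_def)
qed

lemma euler_term_le_weight_term: "(cmod (euler F $ n))\<^sup>2 \<le> 2 * weight_term F n"
proof -
  have "(real n)\<^sup>2 \<le> 2 * ((real n + 1) * (real n + 2) / 2)"
    by (simp add: algebra_simps power2_eq_square)
  from mult_right_mono[OF this, of "(cmod (F $ n))\<^sup>2"] show ?thesis
    by (simp add: weight_term_def norm_mult power_mult_distrib)
qed

lemma summable_weight_term_iff: "summable (weight_term F) \<longleftrightarrow> F \<in> deriv_hardy"
proof
  assume s: "summable (weight_term F)"
  have "summable (\<lambda>n. (cmod (F $ n))\<^sup>2)"
    by (rule summable_comparison_test'[OF s, of 0]) (use hardy_term_le_weight_term in auto)
  moreover have "summable (\<lambda>n. (cmod (euler F $ n))\<^sup>2)"
    by (rule summable_comparison_test'[OF summable_mult[OF s, of 2], of 0])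
       (use euler_term_le_weight_term in \<open>auto simp del: euler_nth\<close>)
  ultimately show "F \<in> deriv_hardy" by (simp add: deriv_hardy_def hardy_def del: euler_nth)
qed (use weight_term_sums sums_summable in blast)

lemma
  assumes "F \<in> deriv_hardy"
  shows hardy_sq_le_deriv: "hardy_sq F \<le> deriv_hardy_sq F"
    and hardy_sq_euler_le_deriv: "hardy_sq (euler F) \<le> 2 * deriv_hardy_sq F"
    and deriv_hardy_sq_le: "deriv_hardy_sq F \<le> 2 * hardy_sq F + 2 * hardy_sq (euler F)"
proof -
  have F: "F \<in> hardy" "euler F \<in> hardy"
    using assms by (auto simp: deriv_hardy_def)
  note w = weight_term_sums[OF assms]
  note h = summable_sums[OF hardy_summable, folded hardy_sq_def]
  show "hardy_sq F \<le> deriv_hardy_sq F"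
    by (rule sums_le[OF hardy_term_le_weight_term h[OF F(1)] w])
  show "hardy_sq (euler F) \<le> 2 * deriv_hardy_sq F"
    by (rule sums_le[OF euler_term_le_weight_term h[OF F(2)] sums_mult[OF w]])
  show "deriv_hardy_sq F \<le> 2 * hardy_sq F + 2 * hardy_sq (euler F)"
    using hardy_sq_add_le[OF F] hardy_sq_nonneg[OF F(1)] hardy_sq_nonneg[OF F(2)]
    unfolding deriv_hardy_sq_def by linarith
qed

lemma deriv_hardy_sq_nonneg: "F \<in> deriv_hardy \<Longrightarrow> 0 \<le> deriv_hardy_sq F"
  using hardy_sq_le_deriv[of F] hardy_sq_nonneg[of F] by (auto simp: deriv_hardy_def)

text \<open>By the Leibniz rule \<open>E (P F) = P (E F) + (E P) F\<close>, and \<open>hardy_sq F + hardy_sq (E F)\<close> is equivalent to the squared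
  norm of the derivative Hardy space.\<close>

lemma deriv_hardy_multiplier:
  assumes "bounded_multiplier P" "bounded_multiplier (euler P)"
  obtains C where "C \<ge> 0" "\<And>F. F \<in> deriv_hardy \<Longrightarrow> P * F \<in> deriv_hardy"
    "\<And>F. F \<in> deriv_hardy \<Longrightarrow> deriv_hardy_sq (P * F) \<le> C * deriv_hardy_sq F"
proof -
  obtain C where C: "C \<ge> 0" "\<And>F. F \<in> hardy \<Longrightarrow> P * F \<in> hardy"
    "\<And>F. F \<in> hardy \<Longrightarrow> hardy_sq (P * F) \<le> C * hardy_sq F"
    using bounded_multiplierE[OF assms(1)] by metis
  obtain D where D: "D \<ge> 0" "\<And>F. F \<in> hardy \<Longrightarrow> euler P * F \<in> hardy"
    "\<And>F. F \<in> hardy \<Longrightarrow> hardy_sq (euler P * F) \<le> D * hardy_sq F"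
    using bounded_multiplierE[OF assms(2)] by metis
  have mem: "P * F \<in> deriv_hardy" if "F \<in> deriv_hardy" for F
    using that by (auto simp: deriv_hardy_def euler_mult intro!: hardy_add C D)
  have bound: "deriv_hardy_sq (P * F) \<le> (10 * C + 4 * D) * deriv_hardy_sq F"
    if F: "F \<in> deriv_hardy" for F
  proof -
    have h: "F \<in> hardy" "euler F \<in> hardy" using F by (auto simp: deriv_hardy_def)
    have "deriv_hardy_sq (P * F) \<le> 2 * hardy_sq (P * F) + 2 * hardy_sq (euler (P * F))"
      by (rule deriv_hardy_sq_le[OF mem[OF F]])
    also have "hardy_sq (euler (P * F)) \<le> 2 * hardy_sq (P * euler F) + 2 * hardy_sq (euler P * F)"
      unfolding euler_mult by (intro hardy_sq_add_le C D h)
    also have "2 * hardy_sq (P * F) + 2 * (2 * hardy_sq (P * euler F) + 2 * hardy_sq (euler P * F))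
      \<le> 2 * (C * deriv_hardy_sq F) + 2 * (2 * (C * (2 * deriv_hardy_sq F)) + 2 * (D * deriv_hardy_sq F))"
      using order_trans[OF C(3)[OF h(1)] mult_left_mono[OF hardy_sq_le_deriv[OF F] C(1)]]
        order_trans[OF C(3)[OF h(2)] mult_left_mono[OF hardy_sq_euler_le_deriv[OF F] C(1)]]
        order_trans[OF D(3)[OF h(1)] mult_left_mono[OF hardy_sq_le_deriv[OF F] D(1)]]
      by (intro add_mono mult_left_mono) auto
    finally show ?thesis by (simp add: algebra_simps)
  qed
  show ?thesis by (rule that[OF _ mem bound]) (use C D in auto)
qed

text \<open>The isometric factor \<open>\<Theta>\<close> is inserted in front of \<open>\<Theta>^k F\<close> and of its Euler derivative; then
  \<open>\<Theta>^k\<close> splits off both and is dropped, again by isometry. What remains depends on \<open>k\<close> only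
  through the scalar in front of \<open>B\<close>.\<close>

lemma deriv_hardy_sq_power_mult:
  assumes \<Theta>: "isometric_multiplier \<Theta>" "bounded_multiplier (euler \<Theta>)" and F: "F \<in> deriv_hardy"
  defines "U \<equiv> \<Theta> * F" and "A \<equiv> \<Theta> * euler F" and "B \<equiv> euler \<Theta> * F"
  shows "deriv_hardy_sq (\<Theta> ^ k * F) = 1/4 * hardy_sq U + 3/4 * hardy_sq ((U + A) + of_nat k * B)
    - 1/4 * hardy_sq (A + of_nat k * B)"
proof -
  have iso: "\<Theta> * G \<in> hardy" "hardy_sq (\<Theta> * G) = hardy_sq G" if "G \<in> hardy" for G
    using \<Theta>(1) that by (auto simp: isometric_multiplier_def)
  have isok: "hardy_sq (\<Theta> ^ k * G) = hardy_sq G" if "G \<in> hardy" for G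
    using isometric_multiplier_power[OF \<Theta>(1)] that by (auto simp: isometric_multiplier_def)
  have mult: "\<Theta> * G \<in> deriv_hardy" if "G \<in> deriv_hardy" for G
    by (rule deriv_hardy_multiplier[OF isometric_multiplier_imp_bounded[OF \<Theta>(1)] \<Theta>(2)])
       (use that in blast)
  have mem: "\<Theta> ^ k * F \<in> deriv_hardy"
    by (induction k) (use F mult in \<open>auto simp: mult.assoc\<close>)
  have h: "\<Theta> ^ k * F \<in> hardy" "euler (\<Theta> ^ k * F) \<in> hardy" "F \<in> hardy" "euler F \<in> hardy"
    using mem F by (auto simp: deriv_hardy_def)
  have UAB: "U \<in> hardy" "A \<in> hardy" "B \<in> hardy"
    unfolding U_def A_def B_def using \<Theta>(2) by (auto intro!: iso h elim: bounded_multiplierE)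
  have 0: "\<Theta> * (\<Theta> ^ k * F) = \<Theta> ^ k * U"
    by (simp add: U_def mult_ac)
  have 1: "\<Theta> * euler (\<Theta> ^ k * F) = \<Theta> ^ k * (A + of_nat k * B)"
  proof -
    have "\<Theta> * euler (\<Theta> ^ k * F) = \<Theta> ^ k * A + (\<Theta> * euler (\<Theta> ^ k)) * F"
      by (simp add: euler_mult A_def algebra_simps)
    then show ?thesis unfolding euler_power by (simp add: B_def algebra_simps)
  qed
  have 2: "\<Theta> * (\<Theta> ^ k * F + euler (\<Theta> ^ k * F)) = \<Theta> ^ k * ((U + A) + of_nat k * B)"
    unfolding distrib_left[of \<Theta>] 0 1 by (simp add: algebra_simps)
  have "hardy_sq (\<Theta> ^ k * F) = hardy_sq U"
    using iso(2)[OF h(1)] isok[OF UAB(1)] 0 by simp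
  moreover have "hardy_sq (euler (\<Theta> ^ k * F)) = hardy_sq (A + of_nat k * B)"
    using iso(2)[OF h(2)] isok[of "A + of_nat k * B"] 1 UAB hardy_add hardy_of_nat_mult by simp
  moreover have "hardy_sq (\<Theta> ^ k * F + euler (\<Theta> ^ k * F)) = hardy_sq ((U + A) + of_nat k * B)"
    using iso(2)[OF hardy_add[OF h(1,2)]] isok[of "(U + A) + of_nat k * B"] 2 UAB
      hardy_add hardy_of_nat_mult by simp
  ultimately show ?thesis by (simp only: deriv_hardy_sq_def)
qed

lemma deriv_hardy_sq_third_difference:
  assumes \<Theta>: "isometric_multiplier \<Theta>" "bounded_multiplier (euler \<Theta>)" and F: "F \<in> deriv_hardy"
  shows "deriv_hardy_sq (\<Theta> ^ 3 * F) - 3 * deriv_hardy_sq (\<Theta> ^ 2 * F)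
    + 3 * deriv_hardy_sq (\<Theta> ^ 1 * F) - deriv_hardy_sq (\<Theta> ^ 0 * F) = 0"
proof -
  have h: "F \<in> hardy" "euler F \<in> hardy" using F by (auto simp: deriv_hardy_def)
  have UAB: "\<Theta> * F \<in> hardy" "\<Theta> * euler F \<in> hardy" "euler \<Theta> * F \<in> hardy"
    using \<Theta> h by (auto simp: isometric_multiplier_def elim: bounded_multiplierE)
  have combine: "(1/4 * u + 3/4 * v3 - 1/4 * w3) - 3 * (1/4 * u + 3/4 * v2 - 1/4 * w2)
      + 3 * (1/4 * u + 3/4 * v1 - 1/4 * w1) - (1/4 * u + 3/4 * v0 - 1/4 * w0) = 0"
    if "v3 - 3 * v2 + 3 * v1 - v0 = 0" "w3 - 3 * w2 + 3 * w1 - w0 = 0"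
    for u v0 v1 v2 v3 w0 w1 w2 w3 :: real
    using that by algebra
  show ?thesis
    unfolding deriv_hardy_sq_power_mult[OF assms]
    by (intro combine hardy_sq_third_difference hardy_add UAB)
qed

section \<open>From functions to power series\<close>

lemma S12_term_eq_weight_term:
  assumes "f has_fps_expansion F"
  shows "S12_term f = weight_term F"
  using fps_nth_fps_expansion[OF assms]
  by (simp add: fun_eq_iff S12_term_def weight_term_def taylor_coeff_def)

lemma S12_norm_sq:
  assumes "f has_fps_expansion F" "F \<in> deriv_hardy"
  shows "(S12_norm f)\<^sup>2 = deriv_hardy_sq F"
  using weight_term_sums[OF assms(2)] deriv_hardy_sq_nonneg[OF assms(2)]
  by (simp add: S12_norm_def S12_term_eq_weight_term[OF assms(1)] sums_iff)

lemma S12_iff: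
  assumes "f has_fps_expansion F"
  shows "f \<in> S12 \<longleftrightarrow> f \<in> analytic_disk \<and> F \<in> deriv_hardy"
  by (simp add: S12_def S12_term_eq_weight_term[OF assms] summable_weight_term_iff)

lemma S12_expansion:
  assumes "f \<in> S12"
  obtains F where "f has_fps_expansion F" "F \<in> deriv_hardy"
proof -
  have "f holomorphic_on ball 0 1" using assms by (auto simp: S12_def analytic_disk_def)
  then have "f has_fps_expansion fps_expansion f 0"
    by (intro has_fps_expansion_fps_expansion[of "ball 0 1"]) auto
  then show ?thesis using that assms S12_iff by blast
qed

lemma finite_blaschke_product_holomorphic:
  assumes "finite_blaschke_product \<theta>"
  shows "\<theta> holomorphic_on ball 0 1"
proof -
  from assms obtain c as where as: "\<forall>a\<in>set as. cmod a < 1"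
    and eq: "\<forall>z\<in>ball 0 1. \<theta> z = c * (\<Prod>a\<leftarrow>as. (z - a) / (1 - cnj a * z))"
    by (auto simp: finite_blaschke_product_def)
  have nz: "1 - cnj a * z \<noteq> 0" if "cmod a < 1" "z \<in> ball 0 1" for a z
  proof
    assume "1 - cnj a * z = 0"
    then have "cmod a * cmod z = 1"
      by (metis complex_mod_cnj eq_iff_diff_eq_0 norm_mult norm_one)
    moreover have "cmod a * cmod z < 1 * 1"
      using that by (intro mult_strict_mono') auto
    ultimately show False by simp
  qed
  have "(\<lambda>z. \<Prod>a\<leftarrow>as. (z - a) / (1 - cnj a * z)) holomorphic_on ball 0 1"
    using as
  proof (induction as)
    case (Cons a as)
    have "(\<lambda>z. (z - a) / (1 - cnj a * z) * (\<Prod>a\<leftarrow>as. (z - a) / (1 - cnj a * z)))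
        holomorphic_on ball 0 1"
      using Cons by (intro holomorphic_on_mult[OF _ Cons.IH] holomorphic_intros nz) auto
    then show ?case by simp
  qed simp
  then have "(\<lambda>z. c * (\<Prod>a\<leftarrow>as. (z - a) / (1 - cnj a * z))) holomorphic_on ball 0 1"
    by (intro holomorphic_intros)
  then show ?thesis by (rule holomorphic_transform) (use eq in auto)
qed

lemma mult_op_funpow: "(mult_op \<theta> ^^ k) f = (\<lambda>z. \<theta> z ^ k * f z)"
  by (induction k) (simp_all add: mult_op_def mult_ac)

theorem theorem3p4:
  fixes \<theta> :: "complex \<Rightarrow> complex"
  assumes "finite_blaschke_product \<theta>"
  shows "m_isometry_on S12 S12_norm 3 (mult_op \<theta>) \<and>
    (\<forall>f\<in>S12. (S12_norm (\<lambda>z. \<theta> z ^ 3 * f z))\<^sup>2 - 3 * (S12_norm (\<lambda>z. \<theta> z ^ 2 * f z))\<^sup>2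
        + 3 * (S12_norm (\<lambda>z. \<theta> z * f z))\<^sup>2 - (S12_norm f)\<^sup>2 = 0)"
proof -
  obtain \<Theta> where \<theta>: "\<theta> has_fps_expansion \<Theta>"
    and \<Theta>: "isometric_multiplier \<Theta>" "bounded_multiplier (euler \<Theta>)"
    using blaschke_product_expansion[OF assms] .
  obtain C where C: "C \<ge> 0" "\<And>F. F \<in> deriv_hardy \<Longrightarrow> \<Theta> * F \<in> deriv_hardy"
    "\<And>F. F \<in> deriv_hardy \<Longrightarrow> deriv_hardy_sq (\<Theta> * F) \<le> C * deriv_hardy_sq F"
    using deriv_hardy_multiplier[OF isometric_multiplier_imp_bounded[OF \<Theta>(1)] \<Theta>(2)] by blast
  have mem: "mult_op \<theta> f \<in> S12" and bound: "S12_norm (mult_op \<theta> f) \<le> sqrt C * S12_norm f"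
    if f: "f \<in> S12" for f
  proof -
    obtain F where F: "f has_fps_expansion F" "F \<in> deriv_hardy"
      using S12_expansion[OF f] .
    have e: "mult_op \<theta> f has_fps_expansion \<Theta> * F"
      unfolding mult_op_def by (rule has_fps_expansion_mult[OF \<theta> F(1)])
    have "mult_op \<theta> f \<in> analytic_disk"
      using f finite_blaschke_product_holomorphic[OF assms]
      by (auto simp: S12_def analytic_disk_def mult_op_def intro!: holomorphic_intros)
    then show "mult_op \<theta> f \<in> S12"
      using S12_iff[OF e] C(2)[OF F(2)] by simp
    have "(S12_norm (mult_op \<theta> f))\<^sup>2 \<le> (sqrt C * S12_norm f)\<^sup>2"
      using C(3)[OF F(2)] C(1) S12_norm_sq[OF e C(2)[OF F(2)]] S12_norm_sq[OF F]
      by (simp add: power_mult_distrib)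
    moreover have "0 \<le> S12_norm f"
      using weight_term_sums[OF F(2)] deriv_hardy_sq_nonneg[OF F(2)]
      by (simp add: S12_norm_def S12_term_eq_weight_term[OF F(1)] sums_iff)
    then have "0 \<le> sqrt C * S12_norm f" using C(1) by simp
    ultimately show "S12_norm (mult_op \<theta> f) \<le> sqrt C * S12_norm f"
      by (rule power2_le_imp_le)
  qed
  have diff: "(S12_norm (\<lambda>z. \<theta> z ^ 3 * f z))\<^sup>2 - 3 * (S12_norm (\<lambda>z. \<theta> z ^ 2 * f z))\<^sup>2
      + 3 * (S12_norm (\<lambda>z. \<theta> z * f z))\<^sup>2 - (S12_norm f)\<^sup>2 = 0" if f: "f \<in> S12" for f
  proof -
    obtain F where F: "f has_fps_expansion F" "F \<in> deriv_hardy"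
      using S12_expansion[OF f] .
    have e: "(\<lambda>z. \<theta> z ^ k * f z) has_fps_expansion \<Theta> ^ k * F" for k
      by (intro has_fps_expansion_mult has_fps_expansion_power \<theta> F)
    have "\<Theta> ^ k * F \<in> deriv_hardy" for k
      by (induction k) (use F C(2) in \<open>auto simp: mult.assoc\<close>)
    then have norm_eq: "(S12_norm (\<lambda>z. \<theta> z ^ k * f z))\<^sup>2 = deriv_hardy_sq (\<Theta> ^ k * F)" for k
      by (rule S12_norm_sq[OF e])
    show ?thesis
      using deriv_hardy_sq_third_difference[OF \<Theta> F(2)]
      unfolding norm_eq[symmetric] by simp
  qed
  have "bounded_operator_on S12 S12_norm (mult_op \<theta>)"
    unfolding bounded_operator_on_def
  proof (intro conjI)
    show "\<exists>C. \<forall>f\<in>S12. S12_norm (mult_op \<theta> f) \<le> C * S12_norm f"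
      using bound by blast
  qed (use mem in \<open>auto simp: mult_op_def fun_eq_iff algebra_simps\<close>)
  moreover have "(\<Sum>k=0..3. (-1) ^ (3 - k) * real (3 choose k) *
      (S12_norm ((mult_op \<theta> ^^ k) f))\<^sup>2) = 0" if "f \<in> S12" for f
  proof -
    have expand: "(\<Sum>k=0..3. (-1) ^ (3 - k) * real (3 choose k) * g k) =
        g 3 - 3 * g 2 + 3 * g 1 - g 0" for g :: "nat \<Rightarrow> real"
      by (simp add: eval_nat_numeral)
    show ?thesis
      unfolding expand mult_op_funpow using diff[OF that] by simp
  qed
  ultimately show ?thesis
    using diff by (intro conjI ballI) (simp_all only: m_isometry_on_def, simp)
qed

end
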